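(* Let $G$ (with distinguished vertices $\mathbf{v}_{\mathrm{in}},\mathbf{v}_{\mathrm{out}}$) satisfy the standing assumptions below, and suppose $G$ has two distinct vertices $v,w\in V(G)\setminus\{\mathbf{v}_{\mathrm{in}},\mathbf{v}_{\mathrm{out}}\}$ with $N(v)=N(w)$. Let $G'=G-w$ (with the same $\mathbf{v}_{\mathrm{in}},\mathbf{v}_{\mathrm{out}}$), and suppose that $\tau_\rho=\mathbf{r}'$ is solvable on $G'$ for every $\mathbf{r}'\in\Psi(G')$. Then for every $\mathbf{r}\in\Psi(G)$, $\tau_\rho=\mathbf{r}$ is solvable on $G$.
   Context: Standing assumptions: $G$ is a finite connected simple undirected graph with distinct distinguished vertices $\mathbf{v}_{\mathrm{in}},\mathbf{v}_{\mathrm{out}}$ such that $G\setminus\mathbf{v}_{\mathrm{out}}$ is connected; $N(x)$ denotes the set of neighbors of $x$. For a weight function $\rho:V\to(0,\infty)$, the $\rho$-walk is the random walk $(v_0,v_1,\ldots)$ with $v_0=\mathbf{v}_{\mathrm{in}}$ which from $x$ moves to a neighbor $y$ with probability $\rho(y)/\sum_{z\in N(x)}\rho(z)$, stopped at the first time $T$ with $v_T=\mathbf{v}_{\mathrm{out}}$; $\tau_\rho(x)$ is the expected number of indices $0\le j\le T$ with $v_j=x$. "$\tau_\rho=\mathbf{r}$ is solvable" means there exists $\rho$ with all values strictly positive with $\tau_\rho=\mathbf{r}$. A proper walk is a walk $\omega=(v_0=\mathbf{v}_{\mathrm{in}},\ldots,v_T=\mathbf{v}_{\mathrm{out}})$ in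 the graph with $v_j\ne\mathbf{v}_{\mathrm{out}}$ for $j<T$; its trace is $\mathrm{tr}_\omega(x)=|\{j:0\le j\le T,\ v_j=x\}|$. $\Psi(\cdot)$ of a graph is the relative interior (interior relative to the affine hull) of the convex hull of the traces of all its proper walks. *)

theory Defs
  imports "HOL-Probability.Probability" "Graph_Theory.Graph_Theory"
begin

text \<open>
  A finite simple undirected graph is a symmetric digraph without loops and multiple arcs, i.e.
  an instance of \<^locale>\<open>graph\<close>. Its vertices live in a finite type \<open>'n\<close>, of which
  \<^term>\<open>verts G\<close> may be a proper subset. Vectors indexed by the vertices are elements of
  \<open>real ^ 'n\<close>, so that a graph and its vertex-deleted subgraph share one ambient space.
\<close>

definition nbrs :: "('a, 'b) pre_digraph \<Rightarrow> 'a \<Rightarrow> 'a set" where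
  "nbrs G x = {y. x \<rightarrow>\<^bsub>G\<^esub> y}"

definition step_pmf :: "('a, 'b) pre_digraph \<Rightarrow> ('a \<Rightarrow> real) \<Rightarrow> 'a \<Rightarrow> 'a pmf" where
  "step_pmf G \<rho> x = embed_pmf (\<lambda>y. if y \<in> nbrs G x then \<rho> y / (\<Sum>z\<in>nbrs G x. \<rho> z) else 0)"

text \<open>
  The walk is realised by an i.i.d. sequence of random maps: the \<open>n\<close>-th map sends each \<open>x\<close>,
  independently, to a vertex with law \<^term>\<open>step_pmf G \<rho> x\<close>, and the walk standing at \<open>x\<close> at time
  \<open>n\<close> moves to the image of \<open>x\<close> under that map. The finite-dimensional distributions
  are computed in \<open>prob_walk_path\<close> below.
\<close>

definition walk_space :: "('n::finite, 'b) pre_digraph \<Rightarrow> ('n \<Rightarrow> real) \<Rightarrow> ('n \<Rightarrow> 'n) stream measure" where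
  "walk_space G \<rho> = stream_space (measure_pmf (Pi_pmf UNIV undefined (step_pmf G \<rho>)))"

primrec walk_at :: "'a \<Rightarrow> nat \<Rightarrow> ('a \<Rightarrow> 'a) stream \<Rightarrow> 'a" where
  "walk_at s 0 \<omega> = s"
| "walk_at s (Suc n) \<omega> = (\<omega> !! n) (walk_at s n \<omega>)"

text \<open>The hitting time is \<open>\<infinity>\<close> if the target is never reached.\<close>

definition hitting_time :: "'a \<Rightarrow> (nat \<Rightarrow> 'a) \<Rightarrow> enat" where
  "hitting_time t X = (INF j\<in>{j. X j = t}. enat j)"

definition visits :: "'a \<Rightarrow> (nat \<Rightarrow> 'a) \<Rightarrow> 'a \<Rightarrow> ennreal" where
  "visits t X x = emeasure (count_space UNIV) {j. enat j \<le> hitting_time t X \<and> X j = x}"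

definition tau :: "('n::finite, 'b) pre_digraph \<Rightarrow> 'n \<Rightarrow> 'n \<Rightarrow> ('n \<Rightarrow> real) \<Rightarrow> 'n \<Rightarrow> ennreal" where
  "tau G vin vout \<rho> x = (\<integral>\<^sup>+\<omega>. visits vout (\<lambda>j. walk_at vin j \<omega>) x \<partial>walk_space G \<rho>)"

definition solvable :: "('n::finite, 'b) pre_digraph \<Rightarrow> 'n \<Rightarrow> 'n \<Rightarrow> real ^ 'n \<Rightarrow> bool" where
  "solvable G vin vout r \<longleftrightarrow>
     (\<exists>\<rho>. (\<forall>x\<in>verts G. \<rho> x > 0) \<and> (\<forall>x\<in>verts G. tau G vin vout \<rho> x = ennreal (r $ x)))"

definition proper_walk :: "('a, 'b) pre_digraph \<Rightarrow> 'a \<Rightarrow> 'a \<Rightarrow> 'a list \<Rightarrow> bool" where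
  "proper_walk G vin vout p \<longleftrightarrow>
     vwalk p G \<and> hd p = vin \<and> last p = vout \<and> vout \<notin> set (butlast p)"

definition walk_trace :: "'n::finite list \<Rightarrow> real ^ 'n" where
  "walk_trace p = (\<chi> x. real (card {j. j < length p \<and> p ! j = x}))"

text \<open>
  Traces vanish off \<^term>\<open>verts G\<close>, so they span a copy of \<open>\<real>\<^sup>V\<close> inside \<open>real ^ 'n\<close>; the relative
  interior does not depend on the ambient space.
\<close>

definition Psi :: "('n::finite, 'b) pre_digraph \<Rightarrow> 'n \<Rightarrow> 'n \<Rightarrow> (real ^ 'n) set" where
  "Psi G vin vout = rel_interior (convex hull (walk_trace ` {p. proper_walk G vin vout p}))"

lemma pmf_step_pmf:
  fixes G :: "('n::finite, 'b) pre_digraph"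
  assumes "nbrs G x \<noteq> {}" and pos: "\<And>z. z \<in> nbrs G x \<Longrightarrow> \<rho> z > 0"
  shows "pmf (step_pmf G \<rho> x) y =
    (if y \<in> nbrs G x then \<rho> y / (\<Sum>z\<in>nbrs G x. \<rho> z) else 0)"
proof -
  let ?f = "\<lambda>y. if y \<in> nbrs G x then \<rho> y / (\<Sum>z\<in>nbrs G x. \<rho> z) else 0"
  have S: "(\<Sum>z\<in>nbrs G x. \<rho> z) > 0"
    using assms by (intro sum_pos) auto
  have nn: "?f z \<ge> 0" for z
    using S pos[of z] by auto
  have "(\<Sum>z\<in>UNIV. ?f z) = (\<Sum>z\<in>nbrs G x. \<rho> z / (\<Sum>z\<in>nbrs G x. \<rho> z))"
    by (simp add: sum.If_cases)
  also have "\<dots> = 1"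
    using S by (simp flip: sum_divide_distrib)
  finally have "(\<integral>\<^sup>+z. ennreal (?f z) \<partial>count_space UNIV) = 1"
    using nn by (subst nn_integral_count_space_finite) (auto simp: sum_ennreal)
  then show ?thesis
    unfolding step_pmf_def using nn by (subst pmf_embed_pmf) auto
qed

lemma walk_at_Stream: "walk_at s (Suc n) (f ## \<omega>) = walk_at (f s) n \<omega>"
  by (induction n) auto

lemma prob_walk_path:
  fixes G :: "('n::finite, 'b) pre_digraph"
  assumes "p 0 = s"
  shows "\<P>(\<omega> in walk_space G \<rho>. \<forall>i\<le>n. walk_at s i \<omega> = p i) =
    (\<Prod>i<n. pmf (step_pmf G \<rho> (p i)) (p (Suc i)))"
  using assms
proof (induction n arbitrary: s p)
  case 0
  interpret prob_space "walk_space G \<rho>"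
    unfolding walk_space_def 
    by (intro prob_space.prob_space_stream_space measure_pmf.prob_space_axioms)
  show ?case using 0 by (simp add: prob_space)
next
  case (Suc n)
  let ?P = "Pi_pmf UNIV undefined (step_pmf G \<rho>)"
  have [measurable]: "walk_at s i \<in> measurable (stream_space (measure_pmf ?P)) (count_space UNIV)" for s i
  proof (induction i)
    case 0
    then show ?case by (simp add: walk_at.simps(1)[abs_def])
  next
    case (Suc i)
    note [measurable] = Suc.IH
    have "(\<lambda>\<omega>. \<omega> !! i) \<in> measurable (stream_space (measure_pmf ?P)) (measure_pmf ?P)"
      by (rule measurable_snth)
    then have [measurable]: "(\<lambda>\<omega>. (\<omega> !! i) x) \<in> measurable (stream_space (measure_pmf ?P)) (count_space UNIV)" for x
      by (rule measurable_compose) simp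
    have "(\<lambda>\<omega>. (\<omega> !! i) (walk_at s i \<omega>)) \<in> measurable (stream_space (measure_pmf ?P)) (count_space UNIV)"
      by (rule measurable_compose_countable[where f = "\<lambda>x \<omega>. (\<omega> !! i) x" and g = "walk_at s i"]) measurable
    then show ?case by simp
  qed
  have split: "(\<forall>i\<le>Suc n. walk_at s i (f ## \<omega>) = p i) \<longleftrightarrow>
      f s = p 1 \<and> (\<forall>i\<le>n. walk_at (p 1) i \<omega> = p (Suc i))" for f \<omega>
  proof -
    have shift: "(\<forall>i\<le>Suc n. Q i) \<longleftrightarrow> Q 0 \<and> (\<forall>i\<le>n. Q (Suc i))" for Q
      by (simp flip: less_Suc_eq_le add: All_less_Suc2)
    have "(\<forall>i\<le>Suc n. walk_at s i (f ## \<omega>) = p i) \<longleftrightarrow>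
        (\<forall>i\<le>n. walk_at s (Suc i) (f ## \<omega>) = p (Suc i))"
      using Suc.prems by (simp only: shift) simp
    also have "\<dots> \<longleftrightarrow> f s = p 1 \<and> (\<forall>i\<le>n. walk_at (p 1) i \<omega> = p (Suc i))"
      unfolding walk_at_Stream by (metis One_nat_def le0 walk_at.simps(1))
    finally show ?thesis .
  qed
  have "{\<omega> \<in> space (stream_space (measure_pmf ?P)). \<forall>i\<le>Suc n. walk_at s i \<omega> = p i}
      \<in> sets (stream_space (measure_pmf ?P))"
    by measurable
  from prob_space.prob_stream_space[OF measure_pmf.prob_space_axioms this]
  have "ennreal (\<P>(\<omega> in walk_space G \<rho>. \<forall>i\<le>Suc n. walk_at s i \<omega> = p i)) =
      (\<integral>\<^sup>+f. ennreal (\<P>(\<omega> in walk_space G \<rho>. f s = p 1 \<and> (\<forall>i\<le>n. walk_at (p 1) i \<omega> = p (Suc i)))) \<partial>?P)"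
    unfolding walk_space_def by (simp only: split)
  also have "\<dots> = (\<integral>\<^sup>+f. ennreal (\<P>(\<omega> in walk_space G \<rho>. \<forall>i\<le>n. walk_at (p 1) i \<omega> = p (Suc i))) *
      indicator {f. f s = p 1} f \<partial>?P)"
    by (intro nn_integral_cong) (auto split: split_indicator)
  also have "\<dots> = ennreal (\<P>(\<omega> in walk_space G \<rho>. \<forall>i\<le>n. walk_at (p 1) i \<omega> = p (Suc i))) *
      emeasure ?P {f. f s = p 1}"
    by (rule nn_integral_cmult_indicator) simp
  also have "\<dots> = ennreal ((\<Prod>i<n. pmf (step_pmf G \<rho> (p (Suc i))) (p (Suc (Suc i)))) *
      measure ?P {f. f s = p 1})"
    using Suc.IH[of "\<lambda>i. p (Suc i)" "p 1"]
    by (simp add: measure_pmf.emeasure_eq_measure ennreal_mult prod_nonneg)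
  also have "measure ?P {f. f s = p 1} = measure (map_pmf (\<lambda>f. f s) ?P) {p 1}"
    by (simp add: vimage_def)
  also have "\<dots> = pmf (step_pmf G \<rho> (p 0)) (p 1)"
    using Suc.prems by (simp add: Pi_pmf_component measure_pmf_single del: measure_map_pmf)
  also have "(\<Prod>i<n. pmf (step_pmf G \<rho> (p (Suc i))) (p (Suc (Suc i)))) *
      pmf (step_pmf G \<rho> (p 0)) (p 1) = (\<Prod>i<Suc n. pmf (step_pmf G \<rho> (p i)) (p (Suc i)))"
    by (simp add: prod.lessThan_Suc_shift mult.commute del: prod.lessThan_Suc)
  finally show ?case
    by (subst (asm) ennreal_inj) (auto intro!: prod_nonneg simp del: prod.lessThan_Suc)
qed

end

theory Submission
  imports Defs
begin

text \<open>
  Merging the coordinates \<open>v\<close> and \<open>w\<close> is a linear map that sends traces of proper walks in \<open>G\<close> onto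
  traces of proper walks in \<open>G - w\<close>, because replacing \<open>w\<close> by \<open>v\<close> in a walk gives a walk. Hence it
  maps \<open>\<Psi>(G)\<close> into \<open>\<Psi>(G - w)\<close>. If \<open>\<rho>'\<close> solves the merged problem, splitting the weight \<open>\<rho>' v\<close> between
  \<open>v\<close> and \<open>w\<close> in the ratio \<open>r v : r w\<close> leaves the merged walk unchanged and splits the visits
  in the same ratio. Both shares are positive because some proper walk visits each of \<open>v\<close>, \<open>w\<close>, so these
  nonnegative coordinates cannot vanish at a relative interior point.
\<close>

section \<open>Expected visits\<close>

text \<open>The probability that the walk from \<open>s\<close> is at \<open>x\<close> at time \<open>n\<close> without having met \<open>t\<close> earlier.\<close>

primrec occ :: "('n::finite, 'b) pre_digraph \<Rightarrow> ('n \<Rightarrow> real) \<Rightarrow> 'n \<Rightarrow> 'n \<Rightarrow> nat \<Rightarrow> 'n \<Rightarrow> real" where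
  "occ G \<rho> t x 0 s = of_bool (s = x)"
| "occ G \<rho> t x (Suc n) s =
     (if s = t then 0 else \<Sum>y\<in>UNIV. pmf (step_pmf G \<rho> s) y * occ G \<rho> t x n y)"

lemma occ_nonneg: "occ G \<rho> t x n s \<ge> 0"
  by (induction n arbitrary: s) (auto intro!: sum_nonneg)

lemma measurable_walk_at [measurable]:
  fixes P :: "('n::finite \<Rightarrow> 'n) pmf"
  shows "walk_at s n \<in> measurable (stream_space (measure_pmf P)) (count_space UNIV)"
proof (induction n)
  case 0
  show ?case by (simp add: walk_at.simps(1)[abs_def])
next
  case (Suc n)
  note [measurable] = Suc.IH
  have "(\<lambda>\<omega>. \<omega> !! n) \<in> measurable (stream_space (measure_pmf P)) (measure_pmf P)"
    by (rule measurable_snth)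
  then have [measurable]:
    "(\<lambda>\<omega>. (\<omega> !! n) x) \<in> measurable (stream_space (measure_pmf P)) (count_space UNIV)" for x
    by (rule measurable_compose) simp
  have "(\<lambda>\<omega>. (\<omega> !! n) (walk_at s n \<omega>)) \<in> measurable (stream_space (measure_pmf P)) (count_space UNIV)"
    by (rule measurable_compose_countable[where f = "\<lambda>x \<omega>. (\<omega> !! n) x" and g = "walk_at s n"]) measurable
  then show ?case by simp
qed

lemma space_walk_space [simp]: "space (walk_space G \<rho>) = UNIV"
  by (simp add: walk_space_def space_stream_space)

lemma sets_walk_before_hit:
  "{\<omega>. walk_at s n \<omega> = x \<and> (\<forall>i<n. walk_at s i \<omega> \<noteq> t)} \<in> sets (walk_space G \<rho>)"
proof -
  have "{\<omega> \<in> space (walk_space G \<rho>). walk_at s n \<omega> = x \<and> (\<forall>i<n. walk_at s i \<omega> \<noteq> t)}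
      \<in> sets (walk_space G \<rho>)"
    unfolding walk_space_def by measurable
  then show ?thesis by simp
qed

text \<open>Markov property: given the first random map \<open>f\<close>, the rest of the stream is
  an independent copy, read from \<open>f s\<close>. This is why \<open>occ\<close> recurses on the
  first step and not on the last.\<close>

lemma emeasure_walk_before_hit:
  "emeasure (walk_space G \<rho>) {\<omega>. walk_at s n \<omega> = x \<and> (\<forall>i<n. walk_at s i \<omega> \<noteq> t)} =
    ennreal (occ G \<rho> t x n s)"
proof (induction n arbitrary: s)
  case 0
  interpret prob_space "walk_space G \<rho>"
    unfolding walk_space_def
    by (intro prob_space.prob_space_stream_space measure_pmf.prob_space_axioms)
  show ?case using emeasure_space_1 by (cases "s = x") auto
next
  case (Suc n)
  let ?P = "Pi_pmf UNIV undefined (step_pmf G \<rho>)"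
  let ?A = "\<lambda>n s. {\<omega>. walk_at s n \<omega> = x \<and> (\<forall>i<n. walk_at s i \<omega> \<noteq> t)}"
  \<comment> \<open>Index \<open>i = 0\<close> of the avoidance condition yields
    \<open>s \<noteq> t\<close>; the other indices shift down by one.\<close>
  have Stream: "f ## \<omega> \<in> ?A (Suc n) s \<longleftrightarrow> s \<noteq> t \<and> \<omega> \<in> ?A n (f s)" for f \<omega>
    unfolding mem_Collect_eq All_less_Suc2 walk_at_Stream by auto
  have "emeasure (walk_space G \<rho>) (?A (Suc n) s) =
      (\<integral>\<^sup>+f. emeasure (walk_space G \<rho>) {\<omega>. f ## \<omega> \<in> ?A (Suc n) s} \<partial>?P)"
    using prob_space.emeasure_stream_space[OF measure_pmf.prob_space_axioms
        sets_walk_before_hit[of s "Suc n" x t G \<rho>, unfolded walk_space_def]]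
    by (simp add: walk_space_def space_stream_space)
  also have "\<dots> = (\<integral>\<^sup>+f. ennreal (if s = t then 0 else occ G \<rho> t x n (f s)) \<partial>?P)"
    unfolding Stream using Suc.IH by (intro nn_integral_cong) auto
  also have "\<dots> = (\<integral>\<^sup>+y. ennreal (if s = t then 0 else occ G \<rho> t x n y) \<partial>map_pmf (\<lambda>f. f s) ?P)"
    by simp
  also have "map_pmf (\<lambda>f. f s) ?P = step_pmf G \<rho> s"
    by (simp add: Pi_pmf_component)
  also have "(\<integral>\<^sup>+y. ennreal (if s = t then 0 else occ G \<rho> t x n y) \<partial>step_pmf G \<rho> s) =
      ennreal (occ G \<rho> t x (Suc n) s)"
    by (subst nn_integral_measure_pmf_support[of UNIV])
      (auto simp: occ_nonneg sum_ennreal ennreal_mult'[symmetric] mult.commute)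
  finally show ?case .
qed

text \<open>The infimum over no times is infinite, so walks that never meet \<open>t\<close> are
  covered. Time \<open>j\<close> itself is unconstrained, so the arrival at \<open>t\<close> counts
  as a visit.\<close>

lemma enat_le_hitting_time: "enat j \<le> hitting_time t X \<longleftrightarrow> (\<forall>i<j. X i \<noteq> t)"
  unfolding hitting_time_def le_INF_iff by (force simp: not_less[symmetric])

lemma visits_eq_suminf:
  "visits t X x = (\<Sum>j. indicator {j. X j = x \<and> (\<forall>i<j. X i \<noteq> t)} j)"
proof -
  have "visits t X x = emeasure (count_space UNIV) {j. X j = x \<and> (\<forall>i<j. X i \<noteq> t)}"
    unfolding visits_def enat_le_hitting_time by (simp add: conj_commute)
  also have "\<dots> = (\<integral>\<^sup>+j. indicator {j. X j = x \<and> (\<forall>i<j. X i \<noteq> t)} j \<partial>count_space UNIV)"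
    by (rule nn_integral_indicator[symmetric]) simp
  finally show ?thesis by (simp add: nn_integral_count_space_nat)
qed

text \<open>Tonelli moves the expectation inside the sum over times, so that two values of
  \<open>tau\<close> can be compared term by term.\<close>

lemma tau_eq_suminf_occ: "tau G vin vout \<rho> x = (\<Sum>n. ennreal (occ G \<rho> vout x n vin))"
proof -
  let ?A = "\<lambda>n. {\<omega>. walk_at vin n \<omega> = x \<and> (\<forall>i<n. walk_at vin i \<omega> \<noteq> vout)}"
  have "tau G vin vout \<rho> x = (\<integral>\<^sup>+\<omega>. (\<Sum>n. indicator (?A n) \<omega>) \<partial>walk_space G \<rho>)"
    unfolding tau_def visits_eq_suminf
    by (intro nn_integral_cong suminf_cong) (auto split: split_indicator)
  also have "\<dots> = (\<Sum>n. \<integral>\<^sup>+\<omega>. indicator (?A n) \<omega> \<partial>walk_space G \<rho>)"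
    by (intro nn_integral_suminf borel_measurable_indicator sets_walk_before_hit)
  also have "\<dots> = (\<Sum>n. ennreal (occ G \<rho> vout x n vin))"
    by (simp only: nn_integral_indicator[OF sets_walk_before_hit] emeasure_walk_before_hit)
  finally show ?thesis .
qed

lemma sum_step_pmf:
  fixes G :: "('n::finite, 'b) pre_digraph"
  assumes "nbrs G s \<noteq> {}" "\<And>z. z \<in> nbrs G s \<Longrightarrow> \<rho> z > 0"
  shows "(\<Sum>y\<in>UNIV. pmf (step_pmf G \<rho> s) y * f y) =
    (\<Sum>y\<in>nbrs G s. \<rho> y * f y) / (\<Sum>y\<in>nbrs G s. \<rho> y)"
proof -
  have "(\<Sum>y\<in>UNIV. pmf (step_pmf G \<rho> s) y * f y) =
      (\<Sum>y\<in>UNIV. if y \<in> nbrs G s then \<rho> y * f y / (\<Sum>y\<in>nbrs G s. \<rho> y) else 0)"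
    by (intro sum.cong) (auto simp: pmf_step_pmf[OF assms])
  then show ?thesis
    by (simp add: sum.If_cases sum_divide_distrib)
qed

section \<open>Twin vertices\<close>

lemma nbrs_del_vert: "nbrs (pre_digraph.del_vert G w) s = (if s = w then {} else nbrs G s - {w})"
  by (auto simp: nbrs_def arcs_ends_conv pre_digraph.del_vert_simps image_iff)

lemma (in wf_digraph) nbrs_subset_verts: "nbrs G s \<subseteq> verts G"
  by (auto simp: nbrs_def)

lemma (in graph) nbrs_commute: "x \<in> nbrs G y \<longleftrightarrow> y \<in> nbrs G x"
  unfolding nbrs_def using arcs_ends_symmetric[OF sym_arcs] by auto

lemma (in graph) not_in_nbrs_self: "x \<notin> nbrs G x"
  unfolding nbrs_def using adj_not_same by auto

lemma (in graph) connected_imp_nbrs_nonempty: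
  assumes "Digraph_Component.connected G" "s \<in> verts G" "u \<in> verts G" "u \<noteq> s"
  shows "nbrs G s \<noteq> {}"
proof -
  have "s \<rightarrow>\<^sup>* u"
    using symmetric_connected_imp_strongly_connected[OF sym_arcs assms(1)] assms(2,3)
    by (auto simp: strongly_connected_def)
  then show ?thesis
    using assms(4) by (cases rule: converse_reachable_cases) (auto simp: nbrs_def)
qed

locale twins = graph G for G :: "('n::finite, 'b) pre_digraph" +
  fixes v w :: 'n
  assumes v: "v \<in> verts G" and w: "w \<in> verts G" and neq: "v \<noteq> w"
    and nbrs_eq: "nbrs G v = nbrs G w"
begin

abbreviation "H \<equiv> pre_digraph.del_vert G w"

definition merge :: "'n \<Rightarrow> 'n" where
  "merge x = (if x = w then v else x)"

definition split_weight :: "real \<Rightarrow> ('n \<Rightarrow> real) \<Rightarrow> 'n \<Rightarrow> real" where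
  "split_weight t \<rho> x = (if x = v then t * \<rho> v else if x = w then (1 - t) * \<rho> v else \<rho> x)"

text \<open>Factor that turns expected visits to \<open>merge x\<close> in \<open>H\<close> into
  expected visits to \<open>x\<close> in \<open>G\<close>.\<close>

definition share :: "real \<Rightarrow> 'n \<Rightarrow> real" where
  "share t x = (if x = v then t else if x = w then 1 - t else 1)"

lemma v_in_nbrs_iff: "v \<in> nbrs G s \<longleftrightarrow> w \<in> nbrs G s"
  using nbrs_commute nbrs_eq by auto

text \<open>Adjacent twins would put \<open>w\<close> into \<open>nbrs G v\<close>, hence into
  \<open>nbrs G w\<close>: a loop.\<close>

lemma twins_not_adjacent: "v \<notin> nbrs G v" "w \<notin> nbrs G v" "v \<notin> nbrs G w" "w \<notin> nbrs G w"
  using not_in_nbrs_self nbrs_eq by auto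

text \<open>\<open>merge\<close> is a graph homomorphism: an arc at \<open>w\<close> is replaced by
  the arc at \<open>v\<close> that the common neighbourhood provides.\<close>

lemma merge_nbrs: "y \<in> nbrs G x \<Longrightarrow> merge y \<in> nbrs H (merge x)"
  using v_in_nbrs_iff nbrs_eq neq twins_not_adjacent by (auto simp: merge_def nbrs_del_vert)

text \<open>Either both twins are neighbours of \<open>s\<close> or neither is; in the first case
  their terms combine into one of weight \<open>\<rho> v\<close>. At the twins only the weighted
  average of \<open>f\<close> is prescribed, since occupation values at time 0 satisfy no
  more.\<close>

lemma sum_split_weight:
  assumes "\<And>y. y \<in> nbrs G s \<Longrightarrow> y \<noteq> v \<Longrightarrow> y \<noteq> w \<Longrightarrow> f y = c * g y"
    and "t * f v + (1 - t) * f w = c * g v" and "s \<noteq> w"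
  shows "(\<Sum>y\<in>nbrs G s. split_weight t \<rho> y * f y) = c * (\<Sum>y\<in>nbrs H s. \<rho> y * g y)"
proof -
  have rest: "(\<Sum>y\<in>nbrs G s - {v, w}. split_weight t \<rho> y * f y) =
      c * (\<Sum>y\<in>nbrs G s - {v, w}. \<rho> y * g y)"
    unfolding sum_distrib_left
    using assms(1) by (intro sum.cong) (auto simp: split_weight_def)
  show ?thesis
  proof (cases "v \<in> nbrs G s")
    case True
    then have G: "nbrs G s = insert v (insert w (nbrs G s - {v, w}))"
      using v_in_nbrs_iff by auto
    have H: "nbrs H s = insert v (nbrs G s - {v, w})"
      using True neq assms(3) by (auto simp: nbrs_del_vert)
    have "(\<Sum>y\<in>nbrs G s. split_weight t \<rho> y * f y) =
        \<rho> v * (t * f v + (1 - t) * f w) + (\<Sum>y\<in>nbrs G s - {v, w}. split_weight t \<rho> y * f y)"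
      using neq by (subst G) (simp add: split_weight_def algebra_simps)
    also have "\<dots> = c * (\<rho> v * g v + (\<Sum>y\<in>nbrs G s - {v, w}. \<rho> y * g y))"
      unfolding rest assms(2) by (simp add: algebra_simps)
    also have "\<rho> v * g v + (\<Sum>y\<in>nbrs G s - {v, w}. \<rho> y * g y) = (\<Sum>y\<in>nbrs H s. \<rho> y * g y)"
      unfolding H by simp
    finally show ?thesis .
  next
    case False
    then have "nbrs G s - {v, w} = nbrs G s" "nbrs H s = nbrs G s"
      using v_in_nbrs_iff assms(3) by (auto simp: nbrs_del_vert)
    then show ?thesis using rest by simp
  qed
qed

section \<open>Expected visits under the split weight\<close>

context
  fixes \<rho> :: "'n \<Rightarrow> real" and t :: real and z x :: 'n
  assumes nbrs_nonempty: "\<And>s. s \<in> verts G \<Longrightarrow> nbrs G s \<noteq> {}"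
    and pos: "\<And>s. s \<in> verts H \<Longrightarrow> \<rho> s > 0"
    and t: "0 < t" "t < 1"
    and z: "z \<noteq> v" "z \<noteq> w"
begin

lemma split_weight_pos: "s \<in> verts G \<Longrightarrow> split_weight t \<rho> s > 0"
  using pos[of s] pos[of v] t v neq by (auto simp: split_weight_def del_vert_simps)

text \<open>
  For \<open>s = v\<close> or \<open>s = w\<close> alone the claim fails at time \<open>0\<close>, hence the averaged second invariant.
\<close>

lemma occ_split_weight:
  "(\<forall>s\<in>verts G - {v, w}. occ G (split_weight t \<rho>) z x n s = share t x * occ H \<rho> z (merge x) n s) \<and>
   t * occ G (split_weight t \<rho>) z x n v + (1 - t) * occ G (split_weight t \<rho>) z x n w =
     share t x * occ H \<rho> z (merge x) n v"
proof (induction n)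
  case 0
  then show ?case using neq by (auto simp: share_def merge_def)
next
  case (Suc n)
  let ?f = "occ G (split_weight t \<rho>) z x" and ?g = "occ H \<rho> z (merge x)" and ?c = "share t x"
  \<comment> \<open>The start \<open>s = v\<close> is included: after one step the identity holds
    pointwise there, because the averaged part of the induction hypothesis is all that
    \<open>sum_split_weight\<close> asks at the twins.\<close>
  have step: "?f (Suc n) s = ?c * ?g (Suc n) s" if s: "s \<in> verts H" "s \<noteq> z" for s
  proof -
    have sG: "s \<in> verts G" "s \<noteq> w" using s by (auto simp: del_vert_simps)
    have "nbrs H s \<noteq> {}"
      using nbrs_nonempty[OF sG(1)] sG(2) v_in_nbrs_iff[of s] neq by (auto simp: nbrs_del_vert)
    moreover have "\<rho> y > 0" if "y \<in> nbrs H s" for y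
      using that nbrs_subset_verts[of s] sG(2) by (intro pos) (auto simp: nbrs_del_vert del_vert_simps)
    ultimately have H: "?g (Suc n) s = (\<Sum>y\<in>nbrs H s. \<rho> y * ?g n y) / (\<Sum>y\<in>nbrs H s. \<rho> y)"
      using s(2) by (simp add: sum_step_pmf)
    have G: "?f (Suc n) s = (\<Sum>y\<in>nbrs G s. split_weight t \<rho> y * ?f n y) /
        (\<Sum>y\<in>nbrs G s. split_weight t \<rho> y)"
      using s(2) nbrs_subset_verts[of s]
      by (simp add: sum_step_pmf nbrs_nonempty[OF sG(1)] split_weight_pos subset_iff)
    have "(\<Sum>y\<in>nbrs G s. split_weight t \<rho> y * ?f n y) = ?c * (\<Sum>y\<in>nbrs H s. \<rho> y * ?g n y)"
      using Suc.IH nbrs_subset_verts[of s] sG(2) by (intro sum_split_weight) auto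
    \<comment> \<open>With constant functions 1, the normalising constants of the two walks
      agree.\<close>
    moreover have "(\<Sum>y\<in>nbrs G s. split_weight t \<rho> y) = (\<Sum>y\<in>nbrs H s. \<rho> y)"
      using sum_split_weight[of s "\<lambda>_. 1" 1 "\<lambda>_. 1" t \<rho>] sG(2) by simp
    ultimately show ?thesis by (simp only: G H times_divide_eq_right)
  qed
  \<comment> \<open>Twins have the same step law, so from time 1 on their occupation values coincide
    and equal their weighted average.\<close>
  have "step_pmf G (split_weight t \<rho>) v = step_pmf G (split_weight t \<rho>) w"
    unfolding step_pmf_def nbrs_eq ..
  then have f_w: "?f (Suc n) w = ?f (Suc n) v"
    using z by simp
  have f_v: "?f (Suc n) v = ?c * ?g (Suc n) v"
    using v neq z by (intro step) (auto simp: del_vert_simps)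
  \<comment> \<open>At \<open>s = z\<close> the walk has stopped and both sides are 0.\<close>
  have "?f (Suc n) s = ?c * ?g (Suc n) s" if "s \<in> verts G - {v, w}" for s
    using that step[of s] by (cases "s = z") (auto simp: del_vert_simps)
  moreover have "t * a + (1 - t) * a = a" for a :: real
    by (simp add: algebra_simps)
  ultimately show ?case
    unfolding f_w f_v by blast
qed

lemma tau_split_weight:
  assumes "s \<in> verts G - {v, w}"
  shows "tau G s z (split_weight t \<rho>) x = ennreal (share t x) * tau H s z \<rho> (merge x)"
proof -
  have "share t x \<ge> 0" using t by (auto simp: share_def)
  moreover have "occ G (split_weight t \<rho>) z x n s = share t x * occ H \<rho> z (merge x) n s" for n
    using occ_split_weight assms by blast
  ultimately show ?thesis
    by (simp add: tau_eq_suminf_occ ennreal_mult occ_nonneg)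
qed

end

section \<open>Merging coordinates of traces\<close>

definition merge_coords :: "real ^ 'n \<Rightarrow> real ^ 'n" where
  "merge_coords r = (\<chi> x. if x = v then r $ v + r $ w else if x = w then 0 else r $ x)"

lemma linear_merge_coords: "linear merge_coords"
  by (rule linearI) (auto simp: merge_coords_def vec_eq_iff algebra_simps)

text \<open>Visits to \<open>v\<close> and to \<open>w\<close> occupy disjoint sets of times, and no
  entry of \<open>map merge p\<close> is \<open>w\<close>, which is why \<open>merge_coords\<close>
  puts 0 there.\<close>

lemma merge_coords_walk_trace: "merge_coords (walk_trace p) = walk_trace (map merge p)"
proof -
  let ?J = "\<lambda>p x. {j. j < length p \<and> p ! j = x}"
  have J_map: "?J (map merge p) x = {j. j < length p \<and> merge (p ! j) = x}" for x
    by (rule Collect_cong) (simp cong: conj_cong)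
  have merge_eq_v: "merge y = v \<longleftrightarrow> y = v \<or> y = w" for y
    by (simp add: merge_def)
  have "?J (map merge p) v = ?J p v \<union> ?J p w"
    unfolding J_map merge_eq_v by blast
  moreover have "card (?J p v \<union> ?J p w) = card (?J p v) + card (?J p w)"
    using neq by (intro card_Un_disjoint) auto
  moreover have "?J (map merge p) w = {}"
    using neq by (auto simp: merge_def)
  moreover have "?J (map merge p) x = ?J p x" if "x \<noteq> v" "x \<noteq> w" for x
    using that by (auto simp: merge_def)
  ultimately show ?thesis
    by (simp add: merge_coords_def walk_trace_def vec_eq_iff)
qed

lemma vwalk_map_merge: "vwalk p G \<Longrightarrow> vwalk (map merge p) H"
proof (induction p)
  case (Cons a p)
  have a: "merge a \<in> verts H"
    using Cons.prems v neq by (auto simp: merge_def del_vert_simps vwalk_def)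
  show ?case
  proof (cases "p = []")
    case True
    then show ?thesis using a by (auto simp: vwalk_def)
  next
    case False
    then have "vwalk p G" "hd p \<in> nbrs G a"
      using Cons.prems by (auto elim: vwalk_consE simp: nbrs_def)
    then have "vwalk (map merge p) H" "(merge a, hd (map merge p)) \<in> arcs_ends H"
      using Cons.IH merge_nbrs False by (auto simp: nbrs_def hd_map)
    then show ?thesis using a by (simp add: vwalk_consI)
  qed
qed (auto simp: vwalk_def)

text \<open>As neither end is a twin, \<open>merge\<close> fixes both and sends no other vertex to
  \<open>b\<close>; the image still meets \<open>b\<close> only at its end.\<close>

lemma proper_walk_map_merge:
  assumes "proper_walk G a b p" "a \<noteq> v" "a \<noteq> w" "b \<noteq> v" "b \<noteq> w"
  shows "proper_walk H a b (map merge p)"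
proof -
  have "p \<noteq> []" using assms(1) by (auto simp: proper_walk_def vwalk_def)
  then show ?thesis
    using assms vwalk_map_merge[of p]
    by (auto simp: proper_walk_def hd_map last_map map_butlast[symmetric] merge_def split: if_splits)
qed

lemma proper_walk_del_vert: "proper_walk H a b p \<Longrightarrow> proper_walk G a b p"
  using subgraph_del_vert by (auto simp: proper_walk_def intro: vwalkI_subgraph)

text \<open>Linear maps commute with convex hulls and with relative interiors of convex sets, so it
  suffices that the traces for \<open>G\<close> are mapped onto those for \<open>H\<close>.\<close>

lemma merge_coords_Psi:
  assumes "a \<noteq> v" "a \<noteq> w" "b \<noteq> v" "b \<noteq> w"
  shows "merge_coords ` Psi G a b = Psi H a b"
proof -
  let ?T = "\<lambda>G. walk_trace ` {p. proper_walk G a b p}"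
  \<comment> \<open>For surjectivity: a walk in \<open>H\<close> avoids \<open>w\<close>, so it is
    its own image and also a walk in \<open>G\<close>.\<close>
  have "map merge p = p" if "proper_walk H a b p" for p
    using that by (intro map_idI) (auto simp: merge_def proper_walk_def vwalk_def del_vert_simps)
  then have "{p. proper_walk H a b p} \<subseteq> map merge ` {p. proper_walk G a b p}"
    using proper_walk_del_vert by (metis (mono_tags) image_eqI mem_Collect_eq subsetI)
  then have "map merge ` {p. proper_walk G a b p} = {p. proper_walk H a b p}"
    using proper_walk_map_merge[OF _ assms] by blast
  moreover have "merge_coords ` ?T G = walk_trace ` map merge ` {p. proper_walk G a b p}"
    by (simp add: image_image merge_coords_walk_trace)
  ultimately have "merge_coords ` ?T G = ?T H" by simp
  then have "merge_coords ` (convex hull ?T G) = convex hull ?T H"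
    by (simp only: convex_hull_linear_image[OF linear_merge_coords])
  then show ?thesis
    unfolding Psi_def
    by (metis rel_interior_convex_linear_image linear_merge_coords convex_convex_hull)
qed

end

section \<open>Positivity of the relative interior\<close>

lemma (in wf_digraph) proper_walk_Cons:
  assumes "proper_walk G y b p" "x \<rightarrow> y" "x \<noteq> b"
  shows "proper_walk G x b (x # p)"
proof -
  have p: "vwalk p G" "hd p = y" "p \<noteq> []"
    using assms(1) by (auto simp: proper_walk_def vwalk_def)
  then have "vwalk (x # p) G"
    using assms(2) by (intro vwalk_consI) auto
  then show ?thesis
    using assms p by (auto simp: proper_walk_def)
qed

text \<open>The walk is built backwards from \<open>b\<close>; whenever the path meets
  \<open>b\<close> again, everything after that point is dropped and the walk restarts as
  \<open>[b]\<close>.\<close>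

lemma (in wf_digraph) reachable_imp_proper_walk:
  assumes "a \<rightarrow>\<^sup>* b"
  shows "\<exists>p. proper_walk G a b p"
  using assms
proof (induction rule: converse_reachable_induct)
  case base
  then have "proper_walk G b b [b]" by (auto simp: proper_walk_def vwalk_def)
  then show ?case ..
next
  case (step x y)
  then obtain p where p: "proper_walk G y b p" by auto
  show ?case
  proof (cases "x = b")
    case True
    then have "proper_walk G x b [b]"
      using step by (auto simp: proper_walk_def vwalk_def)
    then show ?thesis ..
  next
    case False
    then have "proper_walk G x b (x # p)"
      using p step by (intro proper_walk_Cons)
    then show ?thesis ..
  qed
qed

text \<open>The path from \<open>a\<close> to \<open>x\<close> avoids \<open>b\<close>, so
  prepending its vertices to \<open>p\<close> one at a time keeps the walk proper.\<close>

lemma (in wf_digraph) reachable_del_vert_proper_walk: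
  assumes "a \<rightarrow>\<^sup>*\<^bsub>del_vert b\<^esub> x" "proper_walk G x b p"
  shows "\<exists>q. proper_walk G a b q \<and> x \<in> set q"
proof -
  interpret D: wf_digraph "del_vert b" by (rule wf_digraph_del_vert)
  show ?thesis
    using assms(1)
  proof (induction rule: D.converse_reachable_induct)
    case base
    have "x \<in> set p" using assms(2) by (auto simp: proper_walk_def vwalk_def)
    then show ?case using assms(2) by auto
  next
    case (step y z)
    then obtain q where q: "proper_walk G z b q" "x \<in> set q" by auto
    have "(y, z) \<in> arcs_ends G" "y \<noteq> b"
      using step by (auto simp: arcs_ends_conv del_vert_simps)
    then have "proper_walk G y b (y # q)"
      using q(1) by (intro proper_walk_Cons)
    then show ?case using q(2) by (intro exI[of _ "y # q"]) auto
  qed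
qed

text \<open>Connectedness without \<open>b\<close> leads from \<open>a\<close> to \<open>x\<close>
  before \<open>b\<close> is met; connectedness of \<open>G\<close> then leads from \<open>x\<close>
  to \<open>b\<close>.\<close>

lemma (in graph) proper_walk_through:
  assumes "Digraph_Component.connected G" "Digraph_Component.connected (del_vert b)"
    and "a \<in> verts G - {b}" "b \<in> verts G" "x \<in> verts G - {b}"
  shows "\<exists>p. proper_walk G a b p \<and> x \<in> set p"
proof -
  interpret D: wf_digraph "del_vert b" by (rule wf_digraph_del_vert)
  have "symmetric (del_vert b)"
    using sym_arcs unfolding symmetric_conv by (fastforce simp: del_vert_simps)
  then have "a \<rightarrow>\<^sup>*\<^bsub>del_vert b\<^esub> x"
    using D.symmetric_connected_imp_strongly_connected assms
    by (auto simp: strongly_connected_def del_vert_simps)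
  moreover have "x \<rightarrow>\<^sup>* b"
    using symmetric_connected_imp_strongly_connected[OF sym_arcs] assms
    by (auto simp: strongly_connected_def)
  ultimately show ?thesis
    using reachable_imp_proper_walk reachable_del_vert_proper_walk by blast
qed

text \<open>A relative interior point can be pushed slightly away from \<open>walk_trace p\<close>
  without leaving the hull, where coordinates are nonnegative. As the trace is positive at
  \<open>x\<close>, so is \<open>r\<close>.\<close>

lemma Psi_pos:
  assumes "r \<in> Psi G a b" "proper_walk G a b p" "x \<in> set p"
  shows "r $ x > 0"
proof -
  let ?S = "convex hull (walk_trace ` {p. proper_walk G a b p})"
  have "walk_trace p \<in> affine hull ?S"
    using assms(2) by (intro hull_inc) auto
  then obtain e where e: "e > 1" "(1 - e) *\<^sub>R walk_trace p + e *\<^sub>R r \<in> ?S"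
    using convex_rel_interior_if2[of ?S r] assms(1) by (auto simp: Psi_def)
  have "convex {s :: real ^ 'a. 0 \<le> s $ x}"
    by (auto simp: convex_def)
  then have "?S \<subseteq> {s. 0 \<le> s $ x}"
    by (intro hull_minimal) (auto simp: walk_trace_def)
  then have ge: "0 \<le> (1 - e) * walk_trace p $ x + e * r $ x"
    using e(2) by auto
  obtain j where "j < length p" "p ! j = x"
    using assms(3) by (auto simp: in_set_conv_nth)
  then have "walk_trace p $ x > 0"
    by (auto simp: walk_trace_def card_gt_0_iff)
  then have "(e - 1) * walk_trace p $ x > 0" using e(1) by simp
  then have "e * r $ x > 0" using ge by (simp add: algebra_simps)
  then show ?thesis using e(1) by (simp add: zero_less_mult_iff)
qed

theorem theorem6:
  fixes G :: "('n::finite, 'b) pre_digraph" and vin vout v w :: 'n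
  assumes "graph G"
    and "Digraph_Component.connected G"
    and "vin \<in> verts G" and "vout \<in> verts G" and "vin \<noteq> vout"
    and "Digraph_Component.connected (pre_digraph.del_vert G vout)"
    and "v \<in> verts G - {vin, vout}" and "w \<in> verts G - {vin, vout}" and "v \<noteq> w"
    and "nbrs G v = nbrs G w"
    and "\<forall>r'\<in>Psi (pre_digraph.del_vert G w) vin vout.
           solvable (pre_digraph.del_vert G w) vin vout r'"
  shows "\<forall>r\<in>Psi G vin vout. solvable G vin vout r"
proof
  fix r assume r: "r \<in> Psi G vin vout"
  interpret graph G by fact
  interpret twins G v w using assms by unfold_locales auto
  have "r $ x > 0" if "x \<in> {v, w}" for x
    using proper_walk_through[of vout vin x] Psi_pos[OF r] assms that by auto
  then have rpos: "r $ v > 0" "r $ w > 0" by auto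
  \<comment> \<open>The fraction of merged visits due to \<open>v\<close>; \<open>tv\<close> and
    \<open>tw\<close> recover both coordinates from their sum.\<close>
  define t where "t = r $ v / (r $ v + r $ w)"
  have t: "0 < t" "t < 1" and tv: "t * (r $ v + r $ w) = r $ v"
    and tw: "(1 - t) * (r $ v + r $ w) = r $ w"
    using rpos by (auto simp: t_def field_simps)
  have "merge_coords r \<in> Psi H vin vout"
    using r merge_coords_Psi[of vin vout] assms by blast
  then obtain \<rho> where pos: "\<And>x. x \<in> verts H \<Longrightarrow> \<rho> x > 0"
    and tau: "\<And>x. x \<in> verts H \<Longrightarrow> tau H vin vout \<rho> x = ennreal (merge_coords r $ x)"
    using assms(11) unfolding solvable_def by blast
  \<comment> \<open>Since \<open>vin\<close> and \<open>vout\<close> differ, one of them is a vertex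
    other than \<open>s\<close>.\<close>
  have ne: "nbrs G s \<noteq> {}" if "s \<in> verts G" for s
    using that connected_imp_nbrs_nonempty[of s vin] connected_imp_nbrs_nonempty[of s vout] assms by auto
  have "tau G vin vout (split_weight t \<rho>) x = ennreal (r $ x)" if x: "x \<in> verts G" for x
  proof -
    have "tau G vin vout (split_weight t \<rho>) x = ennreal (share t x) * tau H vin vout \<rho> (merge x)"
      using assms by (intro tau_split_weight ne pos t) auto
    also have "merge x \<in> verts H"
      using x v neq by (auto simp: merge_def del_vert_simps)
    then have "tau H vin vout \<rho> (merge x) = ennreal (merge_coords r $ merge x)"
      by (rule tau)
    also have "ennreal (share t x) * \<dots> = ennreal (share t x * merge_coords r $ merge x)"
      using t by (intro ennreal_mult'[symmetric]) (auto simp: share_def)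
    also have "share t x * merge_coords r $ merge x = r $ x"
      using neq tv tw by (auto simp: share_def merge_def merge_coords_def)
    finally show ?thesis .
  qed
  moreover have "\<forall>x\<in>verts G. split_weight t \<rho> x > 0"
    using split_weight_pos[where z = vout and t = t and \<rho> = \<rho>] ne pos t assms by auto
  ultimately show "solvable G vin vout r"
    unfolding solvable_def by auto
qed

end
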